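(* Let $R(z)=R_0+zC(I-zA)^{-1}B+\gamma(zI-\alpha)^{-1}\beta$ be an $m\times m$ rational matrix function with $A$ and $\alpha$ stable and with no poles and no zeros on the unit circle $\mathbb{T}$. With the matrices $D,A_0,B_0,C_0$ and the function $\Psi(z)$ defined in the context, let $Y$ be the solution of the Stein equation \[ Y-\alpha YA_0=\alpha\beta D^{-2}C_0, \] and put \begin{align*} \Xi_0&=R_0D^{-1}-\gamma YA_0B_0D^{-1}-\gamma\beta D^{-2}C_0B_0D^{-1},\\ C_1&=\begin{bmatrix}C&0\end{bmatrix}-R_0D^{-2}C_0-\gamma YA_0^2-\gamma\beta D^{-2}C_0A_0,\\ \beta_1&=(\beta-YB_0)D^{-1}. \end{align*} Then the left unitary factor $\Xi(z)=R(z)\Psi(z)^{-1}$ of $R(z)$ is given by \[ \Xi(z)=\Xi_0+\gamma(zI-\alpha)^{-1}\beta_1+zC_1(I-zA_0)^{-1}B_0D^{-1}. \]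
   Context: All matrices are complex; a square matrix is stable if all its eigenvalues lie in the open unit disc. Zeros of a square rational matrix function are the poles of its inverse. Let $P_+$ and $P_-$ be the unique solutions of $P_+-A^*P_+A=C^*C$ and $P_--\alpha^*P_-\alpha=\gamma^*\gamma$. Put \[ \widetilde A=\begin{bmatrix}A^*& C^*\gamma\\0&\alpha\end{bmatrix},\quad \widetilde B=\begin{bmatrix}C^*R_0+A^*P_+B\\ \beta\end{bmatrix},\quad \widetilde C=\begin{bmatrix}B^*& R_0^*\gamma+\beta^*P_-\alpha\end{bmatrix},\quad \widetilde D=R_0^*R_0+B^*P_+B+\beta^*P_-\beta. \] Let $Q$ be the unique stabilizing solution of \[ Q-\widetilde AQ\widetilde A^*=(\widetilde B-\widetilde AQ\widetilde C^* )(\widetilde D-\widetilde CQ\widetilde C^* )^{-1}(\widetilde B^*-\widetilde CQ\widetilde A^* ), \] i.e. the Hermitian solution for which $\widetilde D-\widetilde CQ\widetilde C^*$ is positive definite and the matrix $A_0$ below is stable (such a $Q$ exists and is unique). Define \[ D=(\widetilde D-\widetilde CQ\widetilde C^* )^{1/2},\quad C_0=\widetilde B^*-\widetilde CQ\widetilde A^*,\quad B_0=\widetilde C^*,\quad A_0=\widetilde A^*-\widetilde C^*D^{-2}C_0, \] and $\Psi(z)=D+zD^{-1}C_0(I-z\widetilde A^* )^{-1}B_0$, which is a rational function with no poles and no zeros on the closed unit disc. The function $\Xi(z)=R(z)\Psi(z)^{-1}$ is called the left unitary factor of $R(z)$. In the formula for $C_1$, the block row $\begin{bmatrix}C&0\end{bmatrix}$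 is partitioned conformally with the block partition of $\widetilde A^*$. *)

theory Defs
  imports
    "HOL-Complex_Analysis.Complex_Analysis"
    "Jordan_Normal_Form.Gauss_Jordan_Elimination"
    "Jordan_Normal_Form.Schur_Decomposition"
begin

text \<open>
  Matrices are those of Jordan Normal Form, with explicit dimensions, so that empty state spaces
  are allowed. A rational matrix function is represented by its pointwise values, a function from
  complex numbers to complex matrices; at the finitely many points where an inverse occurring in
  its defining formula does not exist, its value is arbitrary.
\<close>

notation mat_adjoint (\<open>_\<^sup>\<dagger>\<close> [1000] 999)

text \<open>The value is meaningful only when the argument is invertible.\<close>

definition minv :: "complex mat \<Rightarrow> complex mat" where
  "minv M = the (mat_inverse M)"

text \<open>Block row, the companion of \<^const>\<open>append_rows\<close>.\<close>

definition append_cols_mat :: "complex mat \<Rightarrow> complex mat \<Rightarrow> complex mat" where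
  "append_cols_mat X Y = four_block_mat X Y (0\<^sub>m 0 (dim_col X)) (0\<^sub>m 0 (dim_col Y))"

definition stable_mat :: "complex mat \<Rightarrow> bool" where
  "stable_mat M \<longleftrightarrow> square_mat M \<and> (\<forall>k. eigenvalue M k \<longrightarrow> cmod k < 1)"

definition hermitian_mat :: "complex mat \<Rightarrow> bool" where
  "hermitian_mat M \<longleftrightarrow> M\<^sup>\<dagger> = M"

text \<open>The quadratic form of a Hermitian matrix is real, so taking the real part loses nothing.\<close>

definition pos_def_mat :: "complex mat \<Rightarrow> bool" where
  "pos_def_mat M \<longleftrightarrow> square_mat M \<and> hermitian_mat M \<and>
     (\<forall>v \<in> carrier_vec (dim_row M). v \<noteq> 0\<^sub>v (dim_row M) \<longrightarrow> 0 < Re ((M *\<^sub>v v) \<bullet>c v))"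

text \<open>
  \<^const>\<open>is_pole\<close> depends only on values in a punctured neighbourhood, so the arbitrary values
  at exceptional points are irrelevant here.
\<close>

definition mat_pole :: "nat \<Rightarrow> (complex \<Rightarrow> complex mat) \<Rightarrow> complex \<Rightarrow> bool" where
  "mat_pole m F w \<longleftrightarrow> (\<exists>i<m. \<exists>j<m. is_pole (\<lambda>z. F z $$ (i, j)) w)"

text \<open>
  For a rational square matrix function \<open>F\<close> the following says that the determinant of \<open>F\<close> does
  not vanish identically, i.e. that \<open>F\<close> has an inverse rational matrix function. Zeros are only
  considered for such \<open>F\<close>.
\<close>

definition regular_mat_fun :: "(complex \<Rightarrow> complex mat) \<Rightarrow> bool" where
  "regular_mat_fun F \<longleftrightarrow> finite {z. \<not> invertible_mat (F z)}"

definition mat_zero :: "nat \<Rightarrow> (complex \<Rightarrow> complex mat) \<Rightarrow> complex \<Rightarrow> bool" where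
  "mat_zero m F w \<longleftrightarrow> mat_pole m (\<lambda>z. minv (F z)) w"

end

theory Submission
  imports Defs
begin

text \<open>
  Everything happens at one point \<open>z\<close>.  Write \<open>E = D\<^sup>-\<^sup>1\<close>, \<open>K = D\<^sup>-\<^sup>2 C\<^sub>0\<close>,
  \<open>G = (z I - \<alpha>)\<^sup>-\<^sup>1\<close> and \<open>S = I - z A\<^sub>0\<close>.  The inverse of the realization of \<open>\<Psi>\<close> has state
  matrix \<open>A\<^sub>0\<close>, and with \<open>L = S\<^sup>-\<^sup>1 B\<^sub>0 E\<close> one gets \<open>\<Psi>(z)\<^sup>-\<^sup>1 = E - z K L\<close> together with
  \<open>T\<^sup>-\<^sup>1 B\<^sub>0 \<Psi>(z)\<^sup>-\<^sup>1 = L\<close>, where \<open>T\<close> is the denominator of the state space formula for \<open>\<Psi>(z)\<close>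
  (lemma \<open>transfer_function_inverse\<close>).

  The three summands of \<open>R(z)\<close> are multiplied by \<open>\<Psi>(z)\<^sup>-\<^sup>1\<close> separately.  The constant term gives
  \<open>R\<^sub>0 E - z R\<^sub>0 K L\<close>.  The summand with poles outside the disc has a realization inside that
  of \<open>\<Psi>\<close>: \<open>C (I - z A)\<^sup>-\<^sup>1 B = [C 0] T\<^sup>-\<^sup>1 B\<^sub>0\<close>, because the state matrix is block triangular
  (lemma \<open>block_triangular_transfer_function\<close>), so its product with \<open>\<Psi>(z)\<^sup>-\<^sup>1\<close> collapses to
  \<open>[C 0] L\<close>.  Only the summand with poles inside the disc mixes two resolvents, in the product
  \<open>z G \<beta> K L\<close>.  The Stein equation for \<open>Y\<close> separates them (lemma \<open>stein_partial_fractions\<close>).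
  The claimed formula follows by collecting terms with
  \<open>B\<^sub>0 E = L - z A\<^sub>0 L\<close>, which is the definition of \<open>L\<close>.
\<close>

section \<open>Matrix algebra with explicit dimensions\<close>

lemma assoc_mult_mat_dim:
  fixes X Y Z :: "'a::semiring_0 mat"
  assumes "dim_col X = dim_row Y" "dim_col Y = dim_row Z"
  shows "X * Y * Z = X * (Y * Z)"
  using assms by (intro assoc_mult_mat[of _ "dim_row X" "dim_col X" _ "dim_col Y" _ "dim_col Z"]) auto

lemma add_mult_distrib_mat_dim:
  fixes X Y Z :: "'a::semiring_0 mat"
  assumes "dim_row X = dim_row Y" "dim_col X = dim_col Y" "dim_col Y = dim_row Z"
  shows "(X + Y) * Z = X * Z + Y * Z"
  using assms by (intro add_mult_distrib_mat[of _ "dim_row X" "dim_col X" _ _ "dim_col Z"]) auto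

lemma mult_add_distrib_mat_dim:
  fixes X Y Z :: "'a::semiring_0 mat"
  assumes "dim_col X = dim_row Y" "dim_row Y = dim_row Z" "dim_col Y = dim_col Z"
  shows "X * (Y + Z) = X * Y + X * Z"
  using assms by (intro mult_add_distrib_mat[of _ "dim_row X" "dim_col X" _ "dim_col Y"]) auto

lemma minus_mult_distrib_mat_dim:
  fixes X Y Z :: "'a::ring mat"
  assumes "dim_row X = dim_row Y" "dim_col X = dim_col Y" "dim_col Y = dim_row Z"
  shows "(X - Y) * Z = X * Z - Y * Z"
  using assms by (intro minus_mult_distrib_mat[of _ "dim_row X" "dim_col X" _ _ "dim_col Z"]) auto

lemma mult_minus_distrib_mat_dim:
  fixes X Y Z :: "'a::ring mat"
  assumes "dim_col X = dim_row Y" "dim_row Y = dim_row Z" "dim_col Y = dim_col Z"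
  shows "X * (Y - Z) = X * Y - X * Z"
  using assms by (intro mult_minus_distrib_mat[of _ "dim_row X" "dim_col X" _ "dim_col Y"]) auto

lemma smult_mult_mat_dim:
  fixes X Y :: "'a::comm_semiring_0 mat"
  assumes "dim_col X = dim_row Y"
  shows "(k \<cdot>\<^sub>m X) * Y = k \<cdot>\<^sub>m (X * Y)"
  using assms by (intro mult_smult_assoc_mat[of _ "dim_row X" "dim_col X" _ "dim_col Y"]) auto

lemma mult_smult_mat_dim:
  fixes X Y :: "'a::comm_semiring_0 mat"
  assumes "dim_col X = dim_row Y"
  shows "X * (k \<cdot>\<^sub>m Y) = k \<cdot>\<^sub>m (X * Y)"
  using assms by (intro mult_smult_distrib[of _ "dim_row X" "dim_col X" _ "dim_col Y"]) auto

text \<open>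
  These rules rewrite a matrix expression into a linear combination of right-nested products,
  with side conditions that mention dimensions instead of carriers and so need no instantiation.
  An identity between such combinations is then linear arithmetic in each entry.
\<close>

lemmas mat_expand =
  assoc_mult_mat_dim add_mult_distrib_mat_dim mult_add_distrib_mat_dim
  minus_mult_distrib_mat_dim mult_minus_distrib_mat_dim
  smult_mult_mat_dim mult_smult_mat_dim

lemma mult_mult_eq_mult_mat:
  fixes X Y Z :: "'a::semiring_0 mat"
  assumes "X * Y = Z" "dim_col X = dim_row Y" "dim_col Y = dim_row W"
  shows "X * (Y * W) = Z * W"
  using assms assoc_mult_mat_dim by metis

section \<open>Inverses\<close>

lemma minv_inverse:
  assumes inv: "invertible_mat M" and M: "M \<in> carrier_mat k k"
  shows "minv M \<in> carrier_mat k k" "M * minv M = 1\<^sub>m k" "minv M * M = 1\<^sub>m k"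
proof -
  from inv M obtain N where N: "M * N = 1\<^sub>m k" "N * M = 1\<^sub>m (dim_row N)"
    unfolding invertible_mat_def inverts_mat_def by auto
  have "dim_col (M * N) = k" "dim_col (N * M) = dim_row N" by (simp_all only: N index_one_mat)
  with M have "N \<in> carrier_mat k k" by auto
  with M N have "M \<in> Units (ring_mat TYPE(complex) k ())"
    unfolding Units_def ring_mat_def by auto
  then obtain L where "mat_inverse M = Some L"
    using mat_inverse(1)[OF M, of "()"] by (cases "mat_inverse M") auto
  with mat_inverse(2)[OF M this]
  show "minv M \<in> carrier_mat k k" "M * minv M = 1\<^sub>m k" "minv M * M = 1\<^sub>m k"
    by (auto simp: minv_def)
qed

lemma invertible_mat_if_right_inverse:
  fixes M N :: "'a::field mat"
  assumes "M \<in> carrier_mat k k" "N \<in> carrier_mat k k" "M * N = 1\<^sub>m k"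
  shows "invertible_mat M"
  using assms mat_mult_left_right_inverse[OF assms]
  unfolding invertible_mat_def inverts_mat_def by auto

lemma invertible_mat_if_pos_def:
  assumes D: "D \<in> carrier_mat k k" and pd: "pos_def_mat D"
  shows "invertible_mat D"
proof -
  have "det D \<noteq> 0"
  proof
    assume "det D = 0"
    then obtain v where v: "v \<in> carrier_vec k" "v \<noteq> 0\<^sub>v k" "D *\<^sub>v v = 0\<^sub>v k"
      using det_0_iff_vec_prod_zero[OF D] by blast
    then have "0 < Re ((D *\<^sub>v v) \<bullet>c v)" using pd D by (auto simp: pos_def_mat_def)
    with v show False by simp
  qed
  then obtain N where "inverts_mat D N" "N \<in> carrier_mat k k"
    using det_non_zero_imp_unit[OF D, of "()"] D
    unfolding Units_def ring_mat_def inverts_mat_def by auto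
  with D show ?thesis
    by (auto simp: inverts_mat_def intro: invertible_mat_if_right_inverse)
qed

section \<open>The inverse of a transfer function in state-space form\<close>

text \<open>
  Put \<open>E = D\<^sup>-\<^sup>1\<close>.  The state matrix of the inverse function is invertible because
  \<open>(T + z B E\<^sup>2 C) T\<^sup>-\<^sup>1 B = B E \<Psi>\<close>: the
  perturbation of \<open>T\<close>, seen through \<open>B\<close>, becomes the factor \<open>\<Psi>\<close>.  Solving that relation for \<open>T\<^sup>-\<^sup>1 B \<Psi>\<^sup>-\<^sup>1\<close> gives the
  third conclusion, and inserting this in \<open>E \<Psi> \<Psi>\<^sup>-\<^sup>1 = E\<close> gives the second.
\<close>

lemma transfer_function_inverse:
  fixes T S B C D :: "complex mat"
  assumes T: "T \<in> carrier_mat k k" "invertible_mat T"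
    and D: "D \<in> carrier_mat m m" "invertible_mat D"
    and BC: "B \<in> carrier_mat k m" "C \<in> carrier_mat m k"
    and S: "S = T + z \<cdot>\<^sub>m (B * minv D * minv D * C)"
    and \<Psi>: "\<Psi> = D + z \<cdot>\<^sub>m (minv D * C * minv T * B)" "invertible_mat \<Psi>"
  shows "invertible_mat S"
    and "minv \<Psi> = minv D - z \<cdot>\<^sub>m (minv D * minv D * C * (minv S * B * minv D))"
    and "minv T * B * minv \<Psi> = minv S * B * minv D"
proof -
  define E where "E = minv D"
  define Ti where "Ti = minv T"
  define G where "G = minv \<Psi>"
  note Efacts = minv_inverse[OF D(2,1), folded E_def]
  note Tfacts = minv_inverse[OF T(2,1), folded Ti_def]
  have Sc: "S \<in> carrier_mat k k" using T D BC Efacts by (auto simp: S)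
  have Pc: "\<Psi> \<in> carrier_mat m m"
    using T D BC Efacts Tfacts by (auto simp: \<Psi>(1) E_def Ti_def)
  note Gfacts = minv_inverse[OF \<Psi>(2) Pc, folded G_def]
  note dims = carrier_matD[OF T(1)] carrier_matD[OF D(1)] carrier_matD[OF BC(1)]
    carrier_matD[OF BC(2)] carrier_matD[OF Efacts(1)] carrier_matD[OF Tfacts(1)]
    carrier_matD[OF Gfacts(1)] carrier_matD[OF Sc] carrier_matD[OF Pc]
  have E\<Psi>: "E * \<Psi> = 1\<^sub>m m + z \<cdot>\<^sub>m (E * (E * (C * (Ti * B))))"
    by (simp add: \<Psi>(1) mat_expand dims Efacts(3) flip: E_def Ti_def)
  have STB: "S * (Ti * B) = B * (E * \<Psi>)"
    unfolding E\<Psi>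
    by (simp add: S mat_expand dims mult_mult_eq_mult_mat[OF Tfacts(2)] flip: E_def)
  have STBG: "S * (Ti * (B * G)) = B * E"
  proof -
    have "S * (Ti * (B * G)) = S * (Ti * B) * G" by (simp add: mat_expand dims)
    also have "\<dots> = B * E" unfolding STB by (simp add: mat_expand dims Gfacts(2))
    finally show ?thesis .
  qed
  (* The Sherman-Morrison-Woodbury candidate for the inverse of S. *)
  define X where "X = Ti - z \<cdot>\<^sub>m (Ti * (B * (G * (E * (C * Ti)))))"
  have Xc: "X \<in> carrier_mat k k" by (intro carrier_matI) (simp_all add: X_def dims)
  have "S * X = 1\<^sub>m k"
  proof -
    have "S * (Ti * (B * (G * (E * (C * Ti))))) = S * (Ti * (B * G)) * (E * (C * Ti))"
      by (simp add: mat_expand dims)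
    also have "\<dots> = B * (E * (E * (C * Ti)))" unfolding STBG by (simp add: mat_expand dims)
    finally have *: "S * (Ti * (B * (G * (E * (C * Ti))))) = B * (E * (E * (C * Ti)))" .
    have "S * Ti = 1\<^sub>m k + z \<cdot>\<^sub>m (B * (E * (E * (C * Ti))))"
      by (simp add: S mat_expand dims Tfacts(2) flip: E_def)
    with * show ?thesis
      unfolding X_def by (simp add: mat_expand dims) (intro eq_matI; simp add: dims)
  qed
  then show Sinv: "invertible_mat S" using Sc Xc invertible_mat_if_right_inverse by blast
  note Sfacts = minv_inverse[OF Sinv Sc]
  have TBG: "Ti * (B * G) = minv S * (B * E)"
  proof -
    have "minv S * (S * (Ti * (B * G))) = Ti * (B * G)"
      by (subst mult_mult_eq_mult_mat[OF Sfacts(3)])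
        (simp_all add: dims carrier_matD[OF Sfacts(1)])
    then show ?thesis unfolding STBG by simp
  qed
  then show "minv T * B * minv \<Psi> = minv S * B * minv D"
    by (simp add: mat_expand dims carrier_matD[OF Sfacts(1)] flip: E_def Ti_def G_def)
  have "E = E * \<Psi> * G" by (simp add: mat_expand dims Gfacts(2))
  also have "\<dots> = G + z \<cdot>\<^sub>m (E * (E * (C * (minv S * (B * E)))))"
    unfolding E\<Psi> TBG[symmetric] by (simp add: mat_expand dims)
  finally have EG: "E = G + z \<cdot>\<^sub>m (E * (E * (C * (minv S * (B * E)))))" .
  have "G = G + z \<cdot>\<^sub>m (E * (E * (C * (minv S * (B * E)))))
      - z \<cdot>\<^sub>m (E * (E * (C * (minv S * (B * E)))))"
    by (intro eq_matI) (simp_all add: dims del: index_mult_mat(1))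
  also have "\<dots> = E - z \<cdot>\<^sub>m (E * (E * (C * (minv S * (B * E)))))"
    by (simp only: EG[symmetric])
  finally have "G = \<dots>" .
  then show "minv \<Psi> = minv D - z \<cdot>\<^sub>m (minv D * minv D * C * (minv S * B * minv D))"
    by (simp add: mat_expand dims carrier_matD[OF Sfacts(1)] flip: E_def G_def)
qed

section \<open>Separating two resolvents\<close>

text \<open>
  A partial fraction decomposition: the product of a resolvent of \<open>\<alpha>\<close> and a resolvent of \<open>A\<close>,
  coupled by \<open>\<beta> K\<close>, is a sum of terms containing only one of them.  The Stein equation
  \<open>Y = \<alpha> (Y A + \<beta> K)\<close> is exactly what makes the two sides agree after multiplication by
  \<open>z - \<alpha>\<close>.  To avoid the inverse of \<open>I - z A\<close>, the identity is
  stated for an arbitrary \<open>L\<close>, with \<open>L - z A L\<close> in the place of the input.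
\<close>

lemma stein_partial_fractions:
  fixes \<alpha> \<beta> A K Y L G :: "complex mat"
  assumes c: "\<alpha> \<in> carrier_mat p p" "\<beta> \<in> carrier_mat p m" "A \<in> carrier_mat k k"
      "K \<in> carrier_mat m k" "Y \<in> carrier_mat p k" "L \<in> carrier_mat k r" "G \<in> carrier_mat p p"
    and Y: "Y - \<alpha> * Y * A = \<alpha> * \<beta> * K"
    and G: "G * (z \<cdot>\<^sub>m 1\<^sub>m p - \<alpha>) = 1\<^sub>m p"
  shows "z \<cdot>\<^sub>m (G * \<beta> * K * L) = (Y * A + \<beta> * K) * L + G * Y * (L - z \<cdot>\<^sub>m (A * L))"
proof -
  note dims = c[THEN carrier_matD(1)] c[THEN carrier_matD(2)]
  have "Y = (Y - \<alpha> * Y * A) + \<alpha> * Y * A" by (intro eq_matI) (auto simp: dims)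
  also have "\<dots> = \<alpha> * (\<beta> * K) + \<alpha> * (Y * A)" unfolding Y by (simp add: mat_expand dims)
  finally have "Y * L = (\<alpha> * (\<beta> * K) + \<alpha> * (Y * A)) * L" by (rule arg_cong)
  then have YL: "Y * L = \<alpha> * (\<beta> * (K * L)) + \<alpha> * (Y * (A * L))"
    by (simp add: mat_expand dims)
  let ?W = "Y * (A * L) + \<beta> * (K * L)"
  have "?W = G * (z \<cdot>\<^sub>m 1\<^sub>m p - \<alpha>) * ?W" unfolding G by (simp add: dims)
  also have "\<dots> = z \<cdot>\<^sub>m (G * (Y * (A * L))) + z \<cdot>\<^sub>m (G * (\<beta> * (K * L))) - G * (Y * L)"
    unfolding YL by (simp add: mat_expand dims) 
      (intro eq_matI; simp add: dims distrib_left del: index_mult_mat(1))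
  finally have W: "?W = \<dots>" .
  have "z \<cdot>\<^sub>m (G * (\<beta> * (K * L))) = ?W + (G * (Y * L) - z \<cdot>\<^sub>m (G * (Y * (A * L))))"
    unfolding W by (intro eq_matI) (simp_all add: dims del: index_mult_mat(1))
  then show ?thesis by (simp add: mat_expand dims)
qed

section \<open>Block triangular realizations\<close>

lemma mat_adjoint_carrier [intro]: "M \<in> carrier_mat r c \<Longrightarrow> M\<^sup>\<dagger> \<in> carrier_mat c r"
  unfolding mat_adjoint_def by (auto simp: mat_of_rows_def)

lemma index_mat_adjoint:
  fixes M :: "complex mat"
  assumes "M \<in> carrier_mat r c" "i < c" "j < r"
  shows "M\<^sup>\<dagger> $$ (i, j) = cnj (M $$ (j, i))"
  using assms unfolding mat_adjoint_def by (auto simp: mat_of_rows_def)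

lemma mat_adjoint_adjoint: "(M\<^sup>\<dagger>)\<^sup>\<dagger> = (M :: complex mat)"
proof -
  have M: "M \<in> carrier_mat (dim_row M) (dim_col M)" by simp
  note M' = mat_adjoint_carrier[OF M]
  show ?thesis
    by (intro eq_matI)
      (simp_all add: index_mat_adjoint[OF M'] index_mat_adjoint[OF M]
        carrier_matD[OF mat_adjoint_carrier[OF M']])
qed

lemma mat_adjoint_four_block:
  fixes X Y Z W :: "complex mat"
  assumes c: "X \<in> carrier_mat r1 c1" "Y \<in> carrier_mat r1 c2"
    "Z \<in> carrier_mat r2 c1" "W \<in> carrier_mat r2 c2"
  shows "(four_block_mat X Y Z W)\<^sup>\<dagger> = four_block_mat (X\<^sup>\<dagger>) (Z\<^sup>\<dagger>) (Y\<^sup>\<dagger>) (W\<^sup>\<dagger>)"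
proof -
  have F: "four_block_mat X Y Z W \<in> carrier_mat (r1 + r2) (c1 + c2)" using c by simp
  note a = c[THEN mat_adjoint_carrier]
  note dims = c[THEN carrier_matD(1)] c[THEN carrier_matD(2)]
    a[THEN carrier_matD(1)] a[THEN carrier_matD(2)]
  show ?thesis
    by (intro eq_matI)
      (auto simp: dims index_mat_adjoint[OF F] carrier_matD[OF mat_adjoint_carrier[OF F]]
        index_mat_adjoint[OF c(1)] index_mat_adjoint[OF c(2)]
        index_mat_adjoint[OF c(3)] index_mat_adjoint[OF c(4)])
qed

lemma mat_adjoint_zero: "(0\<^sub>m r c :: complex mat)\<^sup>\<dagger> = 0\<^sub>m c r"
  using mat_adjoint_carrier[of "0\<^sub>m r c :: complex mat" r c]
  by (intro eq_matI) (auto simp: index_mat_adjoint[of _ r c])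

text \<open>
  The state matrix \<open>[A 0; X Z]\<close> is block lower triangular, so the output row \<open>[C 0]\<close> sees
  only the resolvent of \<open>A\<close> and only the upper block of the input matrix.
\<close>

lemma block_triangular_transfer_function:
  fixes A B C X Z W :: "complex mat"
  assumes c: "A \<in> carrier_mat n n" "B \<in> carrier_mat n m" "C \<in> carrier_mat m' n"
      "X \<in> carrier_mat p n" "Z \<in> carrier_mat p p" "W \<in> carrier_mat p m"
    and F: "F = four_block_mat C (0\<^sub>m m' p) (0\<^sub>m 0 n) (0\<^sub>m 0 p)"
    and M: "M = four_block_mat A (0\<^sub>m n p) X Z"
    and N: "N = four_block_mat B (0\<^sub>m n 0) W (0\<^sub>m p 0)"
    and inv: "invertible_mat (1\<^sub>m n - z \<cdot>\<^sub>m A)" "invertible_mat (1\<^sub>m (n + p) - z \<cdot>\<^sub>m M)"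
  shows "F * minv (1\<^sub>m (n + p) - z \<cdot>\<^sub>m M) * N = C * minv (1\<^sub>m n - z \<cdot>\<^sub>m A) * B"
proof -
  define H where "H = minv (1\<^sub>m n - z \<cdot>\<^sub>m A)"
  define T where "T = 1\<^sub>m (n + p) - z \<cdot>\<^sub>m M"
  have "1\<^sub>m n - z \<cdot>\<^sub>m A \<in> carrier_mat n n" using c by (auto simp: minus_carrier_mat)
  note Hf = minv_inverse[OF inv(1) this, folded H_def]
  have "M \<in> carrier_mat (n + p) (n + p)" using c by (simp add: M)
  then have Tc: "T \<in> carrier_mat (n + p) (n + p)" by (auto simp: T_def minus_carrier_mat)
  note Tf = minv_inverse[OF inv(2)[folded T_def] Tc]
  have Tb: "T = four_block_mat (1\<^sub>m n - z \<cdot>\<^sub>m A) (0\<^sub>m n p) (- (z \<cdot>\<^sub>m X)) (1\<^sub>m p - z \<cdot>\<^sub>m Z)"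
    unfolding T_def M using c by (intro eq_matI) auto
  (* The row that solves J * T = F, by back substitution from the zero upper right block of T. *)
  define J where "J = four_block_mat (C * H) (0\<^sub>m m' p) (0\<^sub>m 0 n) (0\<^sub>m 0 p)"
  have Jc: "J \<in> carrier_mat m' (n + p)"
    using four_block_carrier_mat[of "C * H" m' n "0\<^sub>m 0 p" 0 p] c Hf(1) by (simp add: J_def)
  have JT: "J * T = F"
  proof -
    have "J * T = four_block_mat (C * H * (1\<^sub>m n - z \<cdot>\<^sub>m A) + 0\<^sub>m m' p * (- (z \<cdot>\<^sub>m X)))
        (C * H * 0\<^sub>m n p + 0\<^sub>m m' p * (1\<^sub>m p - z \<cdot>\<^sub>m Z))
        (0\<^sub>m 0 n * (1\<^sub>m n - z \<cdot>\<^sub>m A) + 0\<^sub>m 0 p * (- (z \<cdot>\<^sub>m X)))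
        (0\<^sub>m 0 n * 0\<^sub>m n p + 0\<^sub>m 0 p * (1\<^sub>m p - z \<cdot>\<^sub>m Z))"
      unfolding J_def Tb
      by (rule mult_four_block_mat) (use c Hf(1) in \<open>auto simp: minus_carrier_mat\<close>)
    also have "C * H * (1\<^sub>m n - z \<cdot>\<^sub>m A) = C"
      using c Hf by (subst assoc_mult_mat_dim) auto
    finally show ?thesis
      unfolding F using c Hf(1) by (simp add: minus_carrier_mat) (intro eq_matI; auto)
  qed
  have "J = J * (T * minv T)" using Jc Tf by simp
  also have "\<dots> = F * minv T" unfolding JT[symmetric] using Jc Tc Tf(1) by (simp add: assoc_mult_mat_dim)
  finally have FT: "F * minv T = J" by simp
  have "J * N = four_block_mat (C * H * B + 0\<^sub>m m' p * W) (C * H * 0\<^sub>m n 0 + 0\<^sub>m m' p * 0\<^sub>m p 0)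
      (0\<^sub>m 0 n * B + 0\<^sub>m 0 p * W) (0\<^sub>m 0 n * 0\<^sub>m n 0 + 0\<^sub>m 0 p * 0\<^sub>m p 0)"
    unfolding J_def N by (rule mult_four_block_mat) (use c Hf(1) in auto)
  also have "\<dots> = C * H * B" using c Hf(1) by (intro eq_matI) auto
  finally show ?thesis unfolding FT[unfolded T_def] H_def .
qed

section \<open>The left unitary factor\<close>

theorem proposition4p1:
  fixes m n p :: nat
    and R0 A B C \<alpha> \<beta> \<gamma> Pp Pm At Bt Ct Dt Q D A0 B0 C0 Y \<Xi>0 C1 \<beta>1 :: "complex mat"
    and R \<Psi> \<Xi> :: "complex \<Rightarrow> complex mat"
  assumes dims: "R0 \<in> carrier_mat m m"
      "A \<in> carrier_mat n n" "B \<in> carrier_mat n m" "C \<in> carrier_mat m n"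
      "\<alpha> \<in> carrier_mat p p" "\<beta> \<in> carrier_mat p m" "\<gamma> \<in> carrier_mat m p"
    and stable: "stable_mat A" "stable_mat \<alpha>"
    and R: "R = (\<lambda>z. R0 + z \<cdot>\<^sub>m (C * minv (1\<^sub>m n - z \<cdot>\<^sub>m A) * B)
                      + \<gamma> * minv (z \<cdot>\<^sub>m 1\<^sub>m p - \<alpha>) * \<beta>)"
    and regular: "regular_mat_fun R"
    and no_poles: "\<And>w. cmod w = 1 \<Longrightarrow> \<not> mat_pole m R w"
    and no_zeros: "\<And>w. cmod w = 1 \<Longrightarrow> \<not> mat_zero m R w"
    and Pp: "Pp \<in> carrier_mat n n" "Pp - A\<^sup>\<dagger> * Pp * A = C\<^sup>\<dagger> * C"
    and Pm: "Pm \<in> carrier_mat p p" "Pm - \<alpha>\<^sup>\<dagger> * Pm * \<alpha> = \<gamma>\<^sup>\<dagger> * \<gamma>"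
    and At: "At = four_block_mat (A\<^sup>\<dagger>) (C\<^sup>\<dagger> * \<gamma>) (0\<^sub>m p n) \<alpha>"
    and Bt: "Bt = (C\<^sup>\<dagger> * R0 + A\<^sup>\<dagger> * Pp * B) @\<^sub>r \<beta>"
    and Ct: "Ct = append_cols_mat (B\<^sup>\<dagger>) (R0\<^sup>\<dagger> * \<gamma> + \<beta>\<^sup>\<dagger> * Pm * \<alpha>)"
    and Dt: "Dt = R0\<^sup>\<dagger> * R0 + B\<^sup>\<dagger> * Pp * B + \<beta>\<^sup>\<dagger> * Pm * \<beta>"
    and Q: "Q \<in> carrier_mat (n + p) (n + p)" "hermitian_mat Q"
      "Q - At * Q * At\<^sup>\<dagger> =
        (Bt - At * Q * Ct\<^sup>\<dagger>) * minv (Dt - Ct * Q * Ct\<^sup>\<dagger>) * (Bt\<^sup>\<dagger> - Ct * Q * At\<^sup>\<dagger>)"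
      "pos_def_mat (Dt - Ct * Q * Ct\<^sup>\<dagger>)"
      "stable_mat A0"
    and D: "D \<in> carrier_mat m m" "pos_def_mat D" "D * D = Dt - Ct * Q * Ct\<^sup>\<dagger>"
    and C0: "C0 = Bt\<^sup>\<dagger> - Ct * Q * At\<^sup>\<dagger>"
    and B0: "B0 = Ct\<^sup>\<dagger>"
    and A0: "A0 = At\<^sup>\<dagger> - Ct\<^sup>\<dagger> * (minv D ^\<^sub>m 2) * C0"
    and \<Psi>: "\<Psi> = (\<lambda>z. D + z \<cdot>\<^sub>m (minv D * C0 * minv (1\<^sub>m (n + p) - z \<cdot>\<^sub>m At\<^sup>\<dagger>) * B0))"
    and \<Xi>: "\<Xi> = (\<lambda>z. R z * minv (\<Psi> z))"
    and Y: "Y \<in> carrier_mat p (n + p)" "Y - \<alpha> * Y * A0 = \<alpha> * \<beta> * (minv D ^\<^sub>m 2) * C0"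
    and \<Xi>0: "\<Xi>0 = R0 * minv D - \<gamma> * Y * A0 * B0 * minv D
                 - \<gamma> * \<beta> * (minv D ^\<^sub>m 2) * C0 * B0 * minv D"
    and C1: "C1 = append_cols_mat C (0\<^sub>m m p) - R0 * (minv D ^\<^sub>m 2) * C0 - \<gamma> * Y * (A0 ^\<^sub>m 2)
                 - \<gamma> * \<beta> * (minv D ^\<^sub>m 2) * C0 * A0"
    and \<beta>1: "\<beta>1 = (\<beta> - Y * B0) * minv D"
  shows "\<forall>z. invertible_mat (1\<^sub>m n - z \<cdot>\<^sub>m A) \<and> invertible_mat (z \<cdot>\<^sub>m 1\<^sub>m p - \<alpha>) \<and>
             invertible_mat (1\<^sub>m (n + p) - z \<cdot>\<^sub>m At\<^sup>\<dagger>) \<and> invertible_mat (\<Psi> z) \<longrightarrow>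
           invertible_mat (1\<^sub>m (n + p) - z \<cdot>\<^sub>m A0) \<and>
           \<Xi> z = \<Xi>0 + \<gamma> * minv (z \<cdot>\<^sub>m 1\<^sub>m p - \<alpha>) * \<beta>1
                  + z \<cdot>\<^sub>m (C1 * minv (1\<^sub>m (n + p) - z \<cdot>\<^sub>m A0) * B0 * minv D)"
proof (intro allI impI, elim conjE)
  fix z
  assume invA: "invertible_mat (1\<^sub>m n - z \<cdot>\<^sub>m A)"
    and inv\<alpha>: "invertible_mat (z \<cdot>\<^sub>m 1\<^sub>m p - \<alpha>)"
    and invT: "invertible_mat (1\<^sub>m (n + p) - z \<cdot>\<^sub>m At\<^sup>\<dagger>)"
    and inv\<Psi>: "invertible_mat (\<Psi> z)"
  define E where "E = minv D"
  define K where "K = E * E * C0"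
  define T where "T = 1\<^sub>m (n + p) - z \<cdot>\<^sub>m At\<^sup>\<dagger>"
  define S where "S = 1\<^sub>m (n + p) - z \<cdot>\<^sub>m A0"
  define G where "G = minv (z \<cdot>\<^sub>m 1\<^sub>m p - \<alpha>)"
  define L where "L = minv S * B0 * E"
  define F where "F = append_cols_mat C (0\<^sub>m m p)"
  define X where "X = R0\<^sup>\<dagger> * \<gamma> + \<beta>\<^sup>\<dagger> * Pm * \<alpha>"
  note adj = dims[THEN mat_adjoint_carrier]
  have Xc: "X \<in> carrier_mat m p" using adj dims Pm(1) by (auto simp: X_def)
  have Atc: "At \<in> carrier_mat (n + p) (n + p)" using adj dims by (auto simp: At)
  note Atc' = mat_adjoint_carrier[OF Atc]
  have Ctb: "Ct = four_block_mat (B\<^sup>\<dagger>) X (0\<^sub>m 0 n) (0\<^sub>m 0 p)"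
    using carrier_matD[OF adj(3)] carrier_matD[OF Xc] by (simp add: Ct append_cols_mat_def X_def)
  have Ctc: "Ct \<in> carrier_mat m (n + p)"
    using four_block_carrier_mat[OF adj(3), of "0\<^sub>m 0 p" 0 p] by (simp add: Ctb)
  have B0c: "B0 \<in> carrier_mat (n + p) m" using mat_adjoint_carrier[OF Ctc] by (simp add: B0)
  have "Bt \<in> carrier_mat (n + p) m"
    unfolding Bt by (rule carrier_append_rows) (use adj dims Pp(1) in auto)
  then have C0c: "C0 \<in> carrier_mat m (n + p)"
    unfolding C0 using Ctc Q(1) Atc' mat_adjoint_carrier by (auto intro!: minus_carrier_mat)
  note Dinv = invertible_mat_if_pos_def[OF D(1,2)]
  note Ef = minv_inverse[OF Dinv D(1), folded E_def]
  have E2: "minv D ^\<^sub>m 2 = E * E" using Ef(1) by (simp add: E_def numeral_2_eq_2)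
  have Kc: "K \<in> carrier_mat m (n + p)" using Ef(1) C0c by (auto simp: K_def)
  have A0c: "A0 \<in> carrier_mat (n + p) (n + p)"
    unfolding A0 E2 B0[symmetric] using B0c Ef(1) C0c by (auto intro!: minus_carrier_mat)
  have A02: "A0 ^\<^sub>m 2 = A0 * A0" using A0c by (simp add: numeral_2_eq_2)
  have Tc: "T \<in> carrier_mat (n + p) (n + p)" using Atc' by (auto simp: T_def minus_carrier_mat)
  have Sc: "S \<in> carrier_mat (n + p) (n + p)" using A0c by (auto simp: S_def minus_carrier_mat)
  have "z \<cdot>\<^sub>m 1\<^sub>m p - \<alpha> \<in> carrier_mat p p" using dims by (auto simp: minus_carrier_mat)
  note Gf = minv_inverse[OF inv\<alpha> this, folded G_def]
  have Fc: "F \<in> carrier_mat m (n + p)"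
    using four_block_carrier_mat[OF dims(4), of "0\<^sub>m 0 p" 0 p] dims by (simp add: F_def append_cols_mat_def)
  note Tf = minv_inverse[OF invT[folded T_def] Tc]
  note cs = dims Atc' B0c C0c D(1) Ef(1) Kc A0c Tc Sc Gf(1) Fc Y(1) Tf(1)
  note dm = cs[THEN carrier_matD(1)] cs[THEN carrier_matD(2)]

  have "S = T + z \<cdot>\<^sub>m (B0 * minv D * minv D * C0)"
  proof -
    have "A0 = At\<^sup>\<dagger> - B0 * (E * (E * C0))"
      unfolding A0 E2 B0[symmetric] by (simp add: mat_expand dm)
    then show ?thesis
      unfolding S_def T_def E_def[symmetric]
      by (simp add: mat_expand dm) (intro eq_matI; simp add: dm algebra_simps del: index_mult_mat(1))
  qed
  moreover have "\<Psi> z = D + z \<cdot>\<^sub>m (minv D * C0 * minv T * B0)"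
    by (simp add: \<Psi> T_def)
  ultimately have Sinv: "invertible_mat S"
    and \<Psi>i: "minv (\<Psi> z) = E - z \<cdot>\<^sub>m (K * L)"
    and TB: "minv T * B0 * minv (\<Psi> z) = L"
    using transfer_function_inverse[OF Tc invT[folded T_def] D(1) Dinv B0c C0c _ _ inv\<Psi>]
    by (simp_all add: K_def L_def E_def)
  note Sf = minv_inverse[OF Sinv Sc]
  have Lc: "L \<in> carrier_mat (n + p) m" using Sf(1) B0c Ef(1) by (auto simp: L_def)
  note dm = dm carrier_matD[OF Lc] carrier_matD[OF Sf(1)]
  have "B0 * E = S * L"
    unfolding L_def by (simp add: mat_expand dm mult_mult_eq_mult_mat[OF Sf(2)])
  also have "\<dots> = L - z \<cdot>\<^sub>m (A0 * L)" by (simp add: S_def mat_expand dm)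
  finally have B0E: "B0 * E = L - z \<cdot>\<^sub>m (A0 * L)" .

  have CHB: "C * minv (1\<^sub>m n - z \<cdot>\<^sub>m A) * B = F * minv T * B0"
    unfolding T_def
  proof (rule block_triangular_transfer_function[symmetric, OF dims(2-4) _ adj(5) _ _ _ _ invA invT])
    show "(C\<^sup>\<dagger> * \<gamma>)\<^sup>\<dagger> \<in> carrier_mat p n" "X\<^sup>\<dagger> \<in> carrier_mat p m"
      using adj dims Xc by auto
    show "F = four_block_mat C (0\<^sub>m m p) (0\<^sub>m 0 n) (0\<^sub>m 0 p)"
      using dims by (simp add: F_def append_cols_mat_def)
    show "At\<^sup>\<dagger> = four_block_mat A (0\<^sub>m n p) ((C\<^sup>\<dagger> * \<gamma>)\<^sup>\<dagger>) (\<alpha>\<^sup>\<dagger>)"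
      unfolding At using adj dims
      by (subst mat_adjoint_four_block[of _ n n _ p _ p])
        (auto simp: mat_adjoint_adjoint mat_adjoint_zero)
    show "B0 = four_block_mat B (0\<^sub>m n 0) (X\<^sup>\<dagger>) (0\<^sub>m p 0)"
      unfolding B0 Ctb using adj dims Xc
      by (subst mat_adjoint_four_block[of _ m n _ p _ 0])
        (auto simp: mat_adjoint_adjoint mat_adjoint_zero)
  qed
  (* From here on the inverse of \<Psi> z stays atomic until its products have been collapsed by TB. *)
  have "minv (\<Psi> z) \<in> carrier_mat m m"
    unfolding \<Psi>i by (intro carrier_matI) (simp_all add: dm)
  note dm\<Psi> = carrier_matD[OF this]
  have FL: "F * minv T * B0 * minv (\<Psi> z) = F * L"
    unfolding TB[symmetric] by (simp add: mat_expand dm dm\<Psi>)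

  have "Y - \<alpha> * Y * A0 = \<alpha> * \<beta> * K"
    unfolding Y(2) E2 by (simp add: K_def mat_expand dm)
  from stein_partial_fractions[OF dims(5,6) A0c Kc Y(1) Lc Gf(1) this Gf(3)]
  have pf: "z \<cdot>\<^sub>m (G * (\<beta> * (K * L))) =
      Y * (A0 * L) + \<beta> * (K * L) + (G * (Y * L) - z \<cdot>\<^sub>m (G * (Y * (A0 * L))))"
    by (simp add: mat_expand dm)
  have pf\<gamma>: "z \<cdot>\<^sub>m (\<gamma> * (G * (\<beta> * (K * L)))) =
      \<gamma> * (Y * (A0 * L)) + \<gamma> * (\<beta> * (K * L)) + (\<gamma> * (G * (Y * L)) - z \<cdot>\<^sub>m (\<gamma> * (G * (Y * (A0 * L)))))"
    using arg_cong[OF pf, of "\<lambda>M. \<gamma> * M"] by (simp add: mat_expand dm)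

  have "\<Xi> z = R0 * minv (\<Psi> z) + z \<cdot>\<^sub>m (F * L) + \<gamma> * G * \<beta> * minv (\<Psi> z)"
    unfolding \<Xi> R CHB G_def[symmetric] FL[symmetric]
    by (simp add: mat_expand dm dm\<Psi>)
  also have "\<dots> = R0 * E - z \<cdot>\<^sub>m (R0 * (K * L)) + z \<cdot>\<^sub>m (F * L)
      + (\<gamma> * (G * (\<beta> * E)) - z \<cdot>\<^sub>m (\<gamma> * (G * (\<beta> * (K * L)))))"
    unfolding \<Psi>i by (simp add: mat_expand dm)
  (* In \<Xi>0 and \<beta>1 the input matrix occurs only as B0 * E, which B0E expresses through L,
     so both sides become linear in the same monomials. *)
  also have "\<dots> = \<Xi>0 + \<gamma> * G * \<beta>1 + z \<cdot>\<^sub>m (C1 * L)"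
  proof -
    have Kf: "E * (E * C0) = K" by (simp add: K_def mat_expand dm)
    have "\<Xi>0 = R0 * E - \<gamma> * Y * A0 * (B0 * E) - \<gamma> * \<beta> * K * (B0 * E)"
      unfolding \<Xi>0 E2 unfolding E_def[symmetric] by (simp add: mat_expand dm flip: Kf)
    moreover have "\<beta>1 = \<beta> * E - Y * (B0 * E)"
      unfolding \<beta>1 E_def[symmetric] by (simp add: mat_expand dm)
    moreover have "C1 = F - R0 * K - \<gamma> * Y * A0 * A0 - \<gamma> * \<beta> * K * A0"
      unfolding C1 E2 A02 F_def[symmetric] by (simp add: mat_expand dm flip: Kf)
    ultimately show ?thesis
      unfolding pf\<gamma> B0E
      by (simp add: mat_expand dm)
        (intro eq_matI; simp add: dm algebra_simps del: index_mult_mat(1))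
  qed
  also have "C1 * L = C1 * minv S * B0 * minv D"
  proof -
    have "dim_col C1 = n + p" by (simp add: C1 A02 dm)
    then show ?thesis by (simp add: L_def mat_expand dm flip: E_def)
  qed
  finally show "invertible_mat (1\<^sub>m (n + p) - z \<cdot>\<^sub>m A0) \<and>
      \<Xi> z = \<Xi>0 + \<gamma> * minv (z \<cdot>\<^sub>m 1\<^sub>m p - \<alpha>) * \<beta>1
        + z \<cdot>\<^sub>m (C1 * minv (1\<^sub>m (n + p) - z \<cdot>\<^sub>m A0) * B0 * minv D)"
    using Sinv by (simp add: S_def G_def)
qed

end
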